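(* Let $d>1$ be a square-free integer and let $\epsilon=x+y\sqrt{d}$ be the fundamental unit of $\mathbb{Q}(\sqrt{d})$, with $x,y$ integers. If $\mathcal{N}(x+y\sqrt{d})=-1$ and $x\neq 1$, then the group $\langle u,w\rangle$ is free, where $u=x+(y\sqrt{-d})i$ and $w$ is the Gauss $2$-unit $w=y\sqrt{-d}+xk$.
   Context: Let $K=\mathbb{Q}(\sqrt{-d})$ with ring of integers $\mathfrak{o}_K$; $\left(\frac{-1,-1}{K}\right)=K[i,j: i^2=-1,\ j^2=-1,\ -ji=ij=:k]$ and $\left(\frac{-1,-1}{\mathfrak{o}_K}\right)$ is the $\mathfrak{o}_K$-span of $\{1,i,j,k\}$; $u$ and $w$ are units of this ring and $\langle u,w\rangle$ is the subgroup of its unit group that they generate. The norm of $\epsilon=x+y\sqrt{d}$ is $\mathcal{N}(\epsilon)=x^2-dy^2$. The fundamental unit of $\mathbb{Q}(\sqrt d)$ is the fundamental unit $\epsilon=x+y\sqrt d>1$ of its ring of integers, with $x,y>0$. A Gauss $l$-unit is a unit $m\sqrt{-d}+pi+qj+rk$ with $m,p,q,r$ integers, $m\ne0$, $d$ a positive square-free integer, $m^2d\pm1$ a sum of three integer squares, and exactly $l>1$ nonzero coefficients; when $x,y$ are integers with $x^2-dy^2=-1$, the unit $y\sqrt{-d}+xk$ is a Gauss $2$-unit. *)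

theory Defs
  imports
    Complex_Main
    "HOL-Algebra.Ring"
    "HOL-Algebra.Generated_Groups"
    "HOL-Computational_Algebra.Polynomial"
    "HOL-Computational_Algebra.Squarefree"
begin

text \<open>
  \<open>quad_field s\<close> below is the set \<open>\<rat> + \<rat> s\<close>. It is the field \<open>\<rat>(s)\<close> whenever the square
  of \<open>s\<close> is rational, and is only used in that case.
\<close>

definition quad_field :: "'a::field_char_0 \<Rightarrow> 'a set" where
  "quad_field s = {of_rat a + of_rat b * s | a b. True}"

definition ring_of_integers :: "'a::field_char_0 set \<Rightarrow> 'a set" where
  "ring_of_integers K = {z \<in> K. algebraic_int z}"

text \<open>For \<open>d > 0\<close>, \<open>sqrt_neg d\<close> is \<open>\<i> \<surd>d\<close>.\<close>

definition sqrt_neg :: "int \<Rightarrow> complex" where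
  "sqrt_neg d = csqrt (- of_int d)"

definition unit_of_subring :: "'a::comm_ring_1 set \<Rightarrow> 'a \<Rightarrow> bool" where
  "unit_of_subring S z \<longleftrightarrow> z \<in> S \<and> (\<exists>z'\<in>S. z * z' = 1)"

definition fundamental_unit :: "int \<Rightarrow> real \<Rightarrow> bool" where
  "fundamental_unit d \<epsilon> \<longleftrightarrow>
     (let R = ring_of_integers (quad_field (sqrt (of_int d))) in
       unit_of_subring R \<epsilon> \<and> \<epsilon> > 1 \<and>
       (\<forall>\<eta>. unit_of_subring R \<eta> \<longrightarrow> (\<exists>n::int. \<eta> = \<epsilon> powi n \<or> \<eta> = - (\<epsilon> powi n))))"

text \<open>\<open>Quat a b c e\<close> stands for \<open>a + b i + c j + e k\<close>.\<close>

datatype 'a quat = Quat (qre: 'a) (qi: 'a) (qj: 'a) (qk: 'a)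

fun quat_mult :: "'a::comm_ring_1 quat \<Rightarrow> 'a quat \<Rightarrow> 'a quat" where
  "quat_mult (Quat a b c e) (Quat a' b' c' e') =
     Quat (a * a' - b * b' - c * c' - e * e')
          (a * b' + b * a' + c * e' - e * c')
          (a * c' - b * e' + c * a' + e * b')
          (a * e' + b * c' - c * b' + e * a')"

fun quat_add :: "'a::comm_ring_1 quat \<Rightarrow> 'a quat \<Rightarrow> 'a quat" where
  "quat_add (Quat a b c e) (Quat a' b' c' e') = Quat (a + a') (b + b') (c + c') (e + e')"

text \<open>The product is determined by bilinearity, associativity and the defining relations
  \<open>i\<^sup>2 = j\<^sup>2 = -1\<close>, \<open>i j = k = - j i\<close>.\<close>

lemma quat_relations:
  "quat_mult (Quat 0 1 0 0) (Quat 0 1 0 0) = Quat (-1) 0 0 (0 :: 'a::comm_ring_1)"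
  "quat_mult (Quat 0 0 1 0) (Quat 0 0 1 0) = Quat (-1) 0 0 (0 :: 'a)"
  "quat_mult (Quat 0 1 0 0) (Quat 0 0 1 0) = Quat 0 0 0 (1 :: 'a)"
  "quat_mult (Quat 0 0 1 0) (Quat 0 1 0 0) = Quat 0 0 0 (-1 :: 'a)"
  by simp_all

lemma quat_mult_assoc:
  "quat_mult (quat_mult p q) r = quat_mult p (quat_mult q r)"
  by (cases p; cases q; cases r) (simp add: algebra_simps)

text \<open>The span of \<open>1, i, j, k\<close> over a subring \<open>S\<close>.\<close>

definition quat_order :: "'a::comm_ring_1 set \<Rightarrow> 'a quat ring" where
  "quat_order S =
     \<lparr>carrier = {z. qre z \<in> S \<and> qi z \<in> S \<and> qj z \<in> S \<and> qk z \<in> S},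
      monoid.mult = quat_mult, one = Quat 1 0 0 0,
      ring.zero = Quat 0 0 0 0, add = quat_add\<rparr>"

definition quat_integers :: "int \<Rightarrow> complex quat ring" where
  "quat_integers d = quat_order (ring_of_integers (quad_field (sqrt_neg d)))"

definition sum_of_three_squares :: "int \<Rightarrow> bool" where
  "sum_of_three_squares n \<longleftrightarrow> (\<exists>a b c. n = a\<^sup>2 + b\<^sup>2 + c\<^sup>2)"

definition gauss_unit :: "int \<Rightarrow> nat \<Rightarrow> complex quat \<Rightarrow> bool" where
  "gauss_unit d l z \<longleftrightarrow>
     d > 0 \<and> squarefree d \<and> l > 1 \<and> z \<in> Units (quat_integers d) \<and>
     (\<exists>m p q r :: int.
        z = Quat (of_int m * sqrt_neg d) (of_int p) (of_int q) (of_int r) \<and>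
        m \<noteq> 0 \<and>
        (sum_of_three_squares (m\<^sup>2 * d + 1) \<or> sum_of_three_squares (m\<^sup>2 * d - 1)) \<and>
        length (filter (\<lambda>c. c \<noteq> 0) [m, p, q, r]) = l)"

text \<open>A word over \<open>S\<close> is a list of letters \<open>(s, True)\<close> for \<open>s\<close> and \<open>(s, False)\<close> for its formal
  inverse. A group is free with basis \<open>S\<close> if evaluation is a bijection from the reduced words
  over \<open>S\<close>, that is from the elements of the free group on \<open>S\<close>, onto the group.\<close>

definition reduced_words :: "'a set \<Rightarrow> ('a \<times> bool) list set" where
  "reduced_words S =
     {ws. fst ` set ws \<subseteq> S \<and>
          (\<forall>n. Suc n < length ws \<longrightarrow>
             \<not> (fst (ws ! n) = fst (ws ! Suc n) \<and> snd (ws ! n) \<noteq> snd (ws ! Suc n)))}"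

fun word_value :: "('a, 'b) monoid_scheme \<Rightarrow> ('a \<times> bool) list \<Rightarrow> 'a" where
  "word_value G [] = \<one>\<^bsub>G\<^esub>"
| "word_value G ((s, pos) # ws) = (if pos then s else inv\<^bsub>G\<^esub> s) \<otimes>\<^bsub>G\<^esub> word_value G ws"

definition free_basis :: "('a, 'b) monoid_scheme \<Rightarrow> 'a set \<Rightarrow> bool" where
  "free_basis G S \<longleftrightarrow> S \<subseteq> carrier G \<and> bij_betw (word_value G) (reduced_words S) (carrier G)"

definition free_group :: "('a, 'b) monoid_scheme \<Rightarrow> bool" where
  "free_group G \<longleftrightarrow> group G \<and> (\<exists>S. free_basis G S)"

end

theory Submission
  imports Defs "Jordan_Normal_Form.Char_Poly"
begin

text \<open>
  Up to scalars \<open>u\<close> and \<open>w\<close> are real \<open>2 \<times> 2\<close> matrices, acting on the hyperbolic plane as a glide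
  reflection and a translation of the same length along perpendicular axes. The image under \<open>g\<close>
  of the point where the axes meet is encoded by the Hermitian form \<open>g g\<^sup>*\<close>. Cut the plane by the
  two bisectors of the axes into four quarters. Since \<open>x \<ge> 2\<close>, the translation length is large enough
  that each of the four letters maps the complement of the quarter of its inverse into its own
  quarter, and the ping-pong argument applies.

  That the order is closed under multiplication uses that algebraic integers form a ring; sums and
  products are obtained as eigenvalues of integer matrices.
\<close>

section \<open>Rings of algebraic integers\<close>

text \<open>The hypothesis says that \<open>v\<close> is a nonzero eigenvector of the integer matrix
  \<open>M\<close> with eigenvalue \<open>c\<close>, so \<open>c\<close> is a root of the
  characteristic polynomial, which is monic with integer coefficients. The index set is arbitrary so
  that pairs of exponents can serve as indices below; \<open>f\<close> enumerates it to obtain a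
  genuine matrix.\<close>

lemma algebraic_int_eigenvalue:
  fixes c :: "'a::field_char_0" and v :: "'b \<Rightarrow> 'a" and M :: "'b \<Rightarrow> 'b \<Rightarrow> int"
  assumes fin: "finite I" and i0: "i0 \<in> I" "v i0 \<noteq> 0"
    and eq: "\<And>i. i \<in> I \<Longrightarrow> c * v i = (\<Sum>j\<in>I. of_int (M i j) * v j)"
  shows "algebraic_int c"
proof -
  obtain f where f: "bij_betw f {0..<card I} I"
    using ex_bij_betw_nat_finite[OF fin] by blast
  define n where "n = card I"
  define A :: "int mat" where "A = mat n n (\<lambda>(i, j). M (f i) (f j))"
  define V where "V = vec n (v \<circ> f)"
  have A: "A \<in> carrier_mat n n" by (simp add: A_def)
  have fI: "f i \<in> I" if "i < n" for i
    using f that by (auto simp: bij_betw_def n_def)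
  obtain k where k: "k < n" "f k = i0"
    using bij_betw_imp_surj_on[OF f] i0(1) unfolding n_def
    by (metis atLeastLessThan_iff imageE)
  have "map_mat of_int A *\<^sub>v V = c \<cdot>\<^sub>v V"
  proof (rule eq_vecI)
    fix i assume "i < dim_vec (c \<cdot>\<^sub>v V)"
    then have i: "i < n" by (simp add: V_def)
    have "(map_mat of_int A *\<^sub>v V) $ i = (\<Sum>j = 0..<n. of_int (M (f i) (f j)) * v (f j))"
      using i by (simp add: A_def V_def scalar_prod_def)
    also have "\<dots> = (\<Sum>j\<in>I. of_int (M (f i) j) * v j)"
      unfolding n_def by (rule sum.reindex_bij_betw[OF f, of "\<lambda>j. of_int (M (f i) j) * v j"])
    also have "\<dots> = (c \<cdot>\<^sub>v V) $ i"
      using eq[OF fI[OF i]] i by (simp add: V_def)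
    finally show "(map_mat of_int A *\<^sub>v V) $ i = (c \<cdot>\<^sub>v V) $ i" .
  qed (simp add: A_def V_def)
  moreover have "V \<noteq> 0\<^sub>v n"
  proof
    assume "V = 0\<^sub>v n"
    then have "V $ k = 0\<^sub>v n $ k" by simp
    with k i0 show False by (simp add: V_def)
  qed
  ultimately have "eigenvalue (map_mat of_int A) c"
    unfolding eigenvalue_def eigenvector_def by (intro exI[of _ V]) (simp add: A_def V_def)
  then have "poly (char_poly (map_mat of_int A)) c = 0"
    by (subst eigenvalue_root_char_poly[symmetric, of _ n]) (use A in auto)
  then have "poly (map_poly of_int (char_poly A)) c = 0"
    by (simp add: of_int_hom.char_poly_hom[OF A])
  moreover have "lead_coeff (char_poly A) = 1"
    using degree_monic_char_poly[OF A] by simp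
  ultimately show ?thesis
    unfolding algebraic_int_altdef_ipoly by blast
qed

text \<open>Multiplication by \<open>z\<close> maps the span of the powers of \<open>z\<close> below
  the degree of a monic integer polynomial into itself; \<open>P\<close> is the companion matrix of
  that polynomial.\<close>

lemma algebraic_int_companion:
  fixes z :: "'a::field_char_0"
  assumes "algebraic_int z"
  obtains m :: nat and P :: "nat \<Rightarrow> nat \<Rightarrow> int" where "m > 0"
    "\<And>i. i < m \<Longrightarrow> z * z ^ i = (\<Sum>k<m. of_int (P i k) * z ^ k)"
proof -
  obtain p where p: "poly (map_poly of_int p) z = 0" "lead_coeff p = 1"
    using assms unfolding algebraic_int_altdef_ipoly by blast
  define m where "m = degree p"
  \<comment> \<open>All rows but the last shift the exponent by one; the last row rewrites
    \<open>z ^ m\<close> through the lower powers. The case \<open>m = 0\<close> cannot occur, since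
    the polynomial would be the constant 1.\<close>
  define P where "P i k = (if Suc i < m then (if k = Suc i then 1 else 0) else - coeff p k)" for i k
  have deg: "degree (map_poly of_int p :: 'a poly) = m"
    by (simp add: m_def)
  have sum0: "(\<Sum>k<m. of_int (coeff p k) * z ^ k) + z ^ m = 0"
    using p unfolding poly_altdef deg by (simp add: m_def lessThan_Suc_atMost[symmetric])
  have "m > 0"
    using sum0 by (cases m) auto
  moreover have "z * z ^ i = (\<Sum>k<m. of_int (P i k) * z ^ k)" if "i < m" for i
  proof (cases "Suc i < m")
    case True
    have "(\<Sum>k<m. of_int (P i k) * z ^ k) = (\<Sum>k<m. if k = Suc i then z ^ k else 0)"
      by (rule sum.cong) (use True in \<open>auto simp: P_def\<close>)
    then show ?thesis using True by simp
  next
    case False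
    then have "Suc i = m" using that by simp
    then have "z * z ^ i = z ^ m" by auto
    also have "\<dots> = (\<Sum>k<m. of_int (P i k) * z ^ k)"
      using sum0 False by (simp add: P_def sum_negf eq_neg_iff_add_eq_0 add.commute)
    finally show ?thesis .
  qed
  ultimately show ?thesis using that by blast
qed

text \<open>The products \<open>z ^ i * w ^ j\<close> form one common eigenvector: \<open>z\<close>
  acts on it through \<open>P\<close> tensor identity and \<open>w\<close> through identity tensor
  \<open>Q\<close>. Hence \<open>z + w\<close> and \<open>z * w\<close> are eigenvalues of the sum
  and of the product of these two integer matrices. The entry at \<open>(0, 0)\<close> is 1, so the
  vector is nonzero.\<close>

lemma
  fixes z w :: "'a::field_char_0"
  assumes "algebraic_int z" "algebraic_int w"
  shows algebraic_int_plus: "algebraic_int (z + w)"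
    and algebraic_int_times: "algebraic_int (z * w)"
proof -
  obtain m P where m: "m > 0" and P: "\<And>i. i < m \<Longrightarrow> z * z ^ i = (\<Sum>k<m. of_int (P i k) * z ^ k)"
    using algebraic_int_companion[OF assms(1)] by blast
  obtain n Q where n: "n > 0" and Q: "\<And>i. i < n \<Longrightarrow> w * w ^ i = (\<Sum>k<n. of_int (Q i k) * w ^ k)"
    using algebraic_int_companion[OF assms(2)] by blast
  define I where "I = {..<m} \<times> {..<n}"
  define v where "v = (\<lambda>(i, j). z ^ i * w ^ j)"
  have I: "finite I" "(0, 0) \<in> I" "v (0, 0) \<noteq> 0"
    using m n by (auto simp: I_def v_def)
  have zv: "z * v (i, j) = (\<Sum>(k, l)\<in>I. of_int (if l = j then P i k else 0) * v (k, l))"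
    if "(i, j) \<in> I" for i j
  proof -
    have "z * v (i, j) = (\<Sum>k<m. of_int (P i k) * z ^ k) * w ^ j"
      using P[of i] that by (simp add: v_def I_def mult.assoc[symmetric])
    also have "\<dots> = (\<Sum>k<m. \<Sum>l<n. if l = j then of_int (P i k) * v (k, l) else 0)"
      using that by (simp add: I_def v_def sum_distrib_right mult.assoc)
    also have "\<dots> = (\<Sum>(k, l)\<in>I. of_int (if l = j then P i k else 0) * v (k, l))"
      unfolding I_def sum.cartesian_product by (rule sum.cong) auto
    finally show ?thesis .
  qed
  have wv: "w * v (i, j) = (\<Sum>(k, l)\<in>I. of_int (if k = i then Q j l else 0) * v (k, l))"
    if "(i, j) \<in> I" for i j
  proof -
    have "w * v (i, j) = z ^ i * (\<Sum>l<n. of_int (Q j l) * w ^ l)"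
      using Q[of j] that by (simp add: v_def I_def mult.left_commute)
    also have "\<dots> = (\<Sum>l<n. \<Sum>k<m. if k = i then of_int (Q j l) * v (k, l) else 0)"
      using that by (simp add: I_def v_def sum_distrib_left mult_ac)
    also have "\<dots> = (\<Sum>k<m. \<Sum>l<n. if k = i then of_int (Q j l) * v (k, l) else 0)"
      by (rule sum.swap)
    also have "\<dots> = (\<Sum>(k, l)\<in>I. of_int (if k = i then Q j l else 0) * v (k, l))"
      unfolding I_def sum.cartesian_product by (rule sum.cong) auto
    finally show ?thesis .
  qed
  have zwv: "z * w * v (i, j) = (\<Sum>(k, l)\<in>I. of_int (P i k * Q j l) * v (k, l))"
    if "(i, j) \<in> I" for i j
  proof -
    have "z * w * v (i, j) = (z * z ^ i) * (w * w ^ j)"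
      by (simp add: v_def mult_ac)
    also have "\<dots> = (\<Sum>(k, l)\<in>I. (of_int (P i k) * z ^ k) * (of_int (Q j l) * w ^ l))"
      using P[of i] Q[of j] that by (simp add: I_def sum_product sum.cartesian_product)
    also have "\<dots> = (\<Sum>(k, l)\<in>I. of_int (P i k * Q j l) * v (k, l))"
      by (rule sum.cong) (auto simp: v_def)
    finally show ?thesis .
  qed
  show "algebraic_int (z + w)"
  proof (rule algebraic_int_eigenvalue[where v = v, OF I])
    fix p assume "p \<in> I"
    then show "(z + w) * v p = (\<Sum>q\<in>I. of_int ((if snd q = snd p then P (fst p) (fst q) else 0)
        + (if fst q = fst p then Q (snd p) (snd q) else 0)) * v q)"
      using zv[of "fst p" "snd p"] wv[of "fst p" "snd p"]
      by (simp add: distrib_right sum.distrib case_prod_unfold)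
  qed
  show "algebraic_int (z * w)"
  proof (rule algebraic_int_eigenvalue[where v = v, OF I])
    fix p assume "p \<in> I"
    then show "(z * w) * v p =
        (\<Sum>q\<in>I. of_int (P (fst p) (fst q) * Q (snd p) (snd q)) * v q)"
      using zwv[of "fst p" "snd p"] by (simp add: case_prod_unfold)
  qed
qed

section \<open>Quadratic rings of integers and the quaternion order over them\<close>

lemma quad_field_plus: "z \<in> quad_field s \<Longrightarrow> w \<in> quad_field s \<Longrightarrow> z + w \<in> quad_field s"
proof -
  assume "z \<in> quad_field s" "w \<in> quad_field s"
  then obtain a b c e where "z = of_rat a + of_rat b * s" "w = of_rat c + of_rat e * s"
    by (auto simp: quad_field_def)
  then have "z + w = of_rat (a + c) + of_rat (b + e) * s"
    by (simp add: of_rat_add algebra_simps)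
  then show ?thesis unfolding quad_field_def by blast
qed

lemma quad_field_times:
  assumes "s\<^sup>2 = of_rat r" "z \<in> quad_field s" "w \<in> quad_field s"
  shows "z * w \<in> quad_field s"
proof -
  obtain a b c e where "z = of_rat a + of_rat b * s" "w = of_rat c + of_rat e * s"
    using assms by (auto simp: quad_field_def)
  then have "z * w = of_rat (a * c) + of_rat (b * e) * s\<^sup>2 + of_rat (a * e + b * c) * s"
    by (simp add: of_rat_add of_rat_mult algebra_simps power2_eq_square)
  then have "z * w = of_rat (a * c + b * e * r) + of_rat (a * e + b * c) * s"
    by (simp add: assms(1) of_rat_add of_rat_mult)
  then show ?thesis unfolding quad_field_def by blast
qed

lemma of_int_quad_field: "of_int n \<in> quad_field s"
proof -
  have "of_int n = of_rat (of_int n) + of_rat 0 * s" by simp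
  then show ?thesis unfolding quad_field_def by blast
qed

lemma of_int_ring_of_integers_quad_field [simp]:
  "of_int n \<in> ring_of_integers (quad_field s)"
  by (simp add: ring_of_integers_def of_int_quad_field int_imp_algebraic_int)

lemma of_int_times_ring_of_integers_quad_field:
  assumes "algebraic_int s"
  shows "of_int n * s \<in> ring_of_integers (quad_field s)"
proof -
  have "of_int n * s = of_rat 0 + of_rat (of_int n) * s" by simp
  then have "of_int n * s \<in> quad_field s" unfolding quad_field_def by blast
  then show ?thesis
    using assms
    by (auto simp: ring_of_integers_def int_imp_algebraic_int intro!: algebraic_int_times)
qed

lemma ring_of_integers_quad_field_closed:
  assumes "s\<^sup>2 = of_rat r"
    and "z \<in> ring_of_integers (quad_field s)" "w \<in> ring_of_integers (quad_field s)"
  shows "z + w \<in> ring_of_integers (quad_field s)" "z * w \<in> ring_of_integers (quad_field s)"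
    "z - w \<in> ring_of_integers (quad_field s)"
proof -
  have plus: "z + w \<in> ring_of_integers (quad_field s)"
    if "z \<in> ring_of_integers (quad_field s)" "w \<in> ring_of_integers (quad_field s)" for z w
    using that by (auto simp: ring_of_integers_def quad_field_plus intro: algebraic_int_plus)
  have times: "z * w \<in> ring_of_integers (quad_field s)"
    if "z \<in> ring_of_integers (quad_field s)" "w \<in> ring_of_integers (quad_field s)" for z w
    using that quad_field_times[OF assms(1)]
    by (auto simp: ring_of_integers_def intro: algebraic_int_times)
  \<comment> \<open>Negation is multiplication by the integer -1, so closure under differences
    follows from the two closures above.\<close>
  have neg: "- z \<in> ring_of_integers (quad_field s)"
    if "z \<in> ring_of_integers (quad_field s)" for z
    using times[OF of_int_ring_of_integers_quad_field[of "-1"] that] by simp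
  show "z + w \<in> ring_of_integers (quad_field s)" "z * w \<in> ring_of_integers (quad_field s)"
    using plus times assms(2,3) by blast+
  show "z - w \<in> ring_of_integers (quad_field s)"
    using plus[OF assms(2) neg[OF assms(3)]] by simp
qed

lemma monoid_quat_order:
  assumes "0 \<in> S" "1 \<in> S"
    and "\<And>a b. a \<in> S \<Longrightarrow> b \<in> S \<Longrightarrow> a + b \<in> S"
    and "\<And>a b. a \<in> S \<Longrightarrow> b \<in> S \<Longrightarrow> a - b \<in> S"
    and "\<And>a b. a \<in> S \<Longrightarrow> b \<in> S \<Longrightarrow> a * b \<in> S"
  shows "monoid (quat_order S)"
proof (rule monoidI)
  fix p q assume "p \<in> carrier (quat_order S)" "q \<in> carrier (quat_order S)"
  then show "p \<otimes>\<^bsub>quat_order S\<^esub> q \<in> carrier (quat_order S)"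
    by (cases p; cases q) (simp add: quat_order_def assms)
next
  fix p assume "p \<in> carrier (quat_order S)"
  show "\<one>\<^bsub>quat_order S\<^esub> \<otimes>\<^bsub>quat_order S\<^esub> p = p" "p \<otimes>\<^bsub>quat_order S\<^esub> \<one>\<^bsub>quat_order S\<^esub> = p"
    by (cases p; simp add: quat_order_def)+
qed (simp_all add: quat_order_def quat_mult_assoc assms)

lemma sqrt_neg_eq: "d > 0 \<Longrightarrow> sqrt_neg d = \<i> * of_real (sqrt (of_int d))"
  by (simp add: sqrt_neg_def)

lemma sqrt_neg_power2: "(sqrt_neg d)\<^sup>2 = of_rat (of_int (- d))"
  by (simp add: sqrt_neg_def of_rat_minus)

lemma algebraic_int_sqrt_neg: "algebraic_int (sqrt_neg d)"
  unfolding sqrt_neg_def by (intro algebraic_int_csqrt algebraic_int_minus int_imp_algebraic_int) simp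

lemma monoid_quat_integers: "monoid (quat_integers d)"
proof -
  note closed = ring_of_integers_quad_field_closed[OF sqrt_neg_power2]
  show ?thesis
    unfolding quat_integers_def
    by (rule monoid_quat_order)
      (use closed of_int_ring_of_integers_quad_field[of 0 "sqrt_neg d"]
        of_int_ring_of_integers_quad_field[of 1 "sqrt_neg d"] in auto)
qed

section \<open>Free groups\<close>

lemma reduced_words_Nil [simp]: "[] \<in> reduced_words S"
  by (simp add: reduced_words_def)

lemma reduced_words_Cons:
  "(s, b) # ws \<in> reduced_words S \<longleftrightarrow>
     s \<in> S \<and> ws \<in> reduced_words S \<and> (\<forall>ws'. ws \<noteq> (s, \<not> b) # ws')"
proof -
  \<comment> \<open>Separating \<open>n = 0\<close> splits the condition on neighbouring letters
    into the one for the first two letters and the one for the tail.\<close>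
  have "(\<forall>n. P n) \<longleftrightarrow> P 0 \<and> (\<forall>n. P (Suc n))" for P :: "nat \<Rightarrow> bool"
    by (metis nat.exhaust)
  note split = this[of "\<lambda>n. Suc n < length ((s, b) # ws) \<longrightarrow> \<not> (fst (((s, b) # ws) ! n) =
    fst (((s, b) # ws) ! Suc n) \<and> snd (((s, b) # ws) ! n) \<noteq> snd (((s, b) # ws) ! Suc n))"]
  show ?thesis
    unfolding reduced_words_def mem_Collect_eq split by (cases ws) auto
qed

context group
begin

lemma word_value_closed:
  "S \<subseteq> carrier G \<Longrightarrow> fst ` set ws \<subseteq> S \<Longrightarrow> word_value G ws \<in> carrier G"
  by (induction ws) auto

lemma word_value_reduced_closed:
  "S \<subseteq> carrier G \<Longrightarrow> ws \<in> reduced_words S \<Longrightarrow> word_value G ws \<in> carrier G"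
  by (rule word_value_closed) (auto simp: reduced_words_def)

text \<open>A letter put in front of a reduced word either cancels against its first letter, which
  leaves the reduced tail, or gives a longer reduced word.\<close>

lemma word_value_letter_image:
  assumes "S \<subseteq> carrier G" "s \<in> S" "g \<in> word_value G ` reduced_words S"
  shows "(if b then s else inv s) \<otimes> g \<in> word_value G ` reduced_words S"
proof -
  obtain ws where ws: "ws \<in> reduced_words S" "g = word_value G ws"
    using assms by blast
  show ?thesis
  proof (cases "\<exists>ws'. ws = (s, \<not> b) # ws'")
    case True
    then obtain ws' where ws': "ws = (s, \<not> b) # ws'" by blast
    then have red: "ws' \<in> reduced_words S"
      using ws by (simp add: reduced_words_Cons)
    have "s \<in> carrier G" "word_value G ws' \<in> carrier G"
      using assms word_value_reduced_closed red by auto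
    then have "(if b then s else inv s) \<otimes> g = word_value G ws'"
      by (simp add: ws ws' m_assoc[symmetric])
    then show ?thesis using red by simp
  next
    case False
    then have "(s, b) # ws \<in> reduced_words S"
      using assms ws by (simp add: reduced_words_Cons)
    then show ?thesis using ws by (intro image_eqI[of _ _ "(s, b) # ws"]) simp_all
  qed
qed

lemma word_value_image_reduced_words:
  assumes S: "S \<subseteq> carrier G"
  shows "word_value G ` reduced_words S = generate G S"
proof
  have "word_value G ws \<in> generate G S" if "fst ` set ws \<subseteq> S" for ws
    using that
    by (induction ws)
      (auto intro: generate.one generate.eng[OF generate.incl] generate.eng[OF generate.inv])
  then show "word_value G ` reduced_words S \<subseteq> generate G S"
    by (auto simp: reduced_words_def)
  \<comment> \<open>Membership of \<open>g\<close> alone would not survive the product case of the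
    induction. Invariance of the set under left multiplication by \<open>g\<close> does, by
    associativity; taking \<open>h\<close> to be the identity recovers membership.\<close>
  have "g \<otimes> h \<in> word_value G ` reduced_words S"
    if "g \<in> generate G S" "h \<in> word_value G ` reduced_words S" for g h
    using that
  proof (induction arbitrary: h rule: generate.induct)
    case one
    then show ?case using word_value_reduced_closed[OF S] by auto
  next
    case (incl s)
    then show ?case using word_value_letter_image[OF S, of s h True] by simp
  next
    case (inv s)
    then show ?case using word_value_letter_image[OF S, of s h False] by simp
  next
    case (eng g1 g2)
    have "g1 \<in> carrier G" "g2 \<in> carrier G" "h \<in> carrier G"
      using eng generate_in_carrier[OF S] word_value_reduced_closed[OF S] by auto
    then show ?case using eng by (simp add: m_assoc)
  qed
  moreover have "\<one> \<in> word_value G ` reduced_words S"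
    by (intro image_eqI[of _ _ "[]"]) simp_all
  ultimately show "generate G S \<subseteq> word_value G ` reduced_words S"
    using generate_in_carrier[OF S] by (metis r_one subsetI)
qed

text \<open>The group acts on itself by left multiplication, and \<open>D s b\<close> is the domain
  of the letter \<open>(s, b)\<close>. The value of a nonempty reduced word lies in the domain of
  its first letter, so it differs from the identity, and disjointness lets the first letter be read
  off and cancelled.\<close>

lemma ping_pong_inj_on_word_value:
  fixes D :: "'a \<Rightarrow> bool \<Rightarrow> 'a set"
  assumes S: "S \<subseteq> carrier G"
    and one: "\<And>s b. s \<in> S \<Longrightarrow> \<one> \<notin> D s b"
    and disj: "\<And>s b t c g. s \<in> S \<Longrightarrow> t \<in> S \<Longrightarrow> g \<in> carrier G \<Longrightarrow> g \<in> D s b \<Longrightarrow> g \<in> D t c \<Longrightarrow>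
      s = t \<and> b = c"
    and step: "\<And>s b g. s \<in> S \<Longrightarrow> g \<in> carrier G \<Longrightarrow> g \<notin> D s (\<not> b) \<Longrightarrow>
      (if b then s else inv s) \<otimes> g \<in> D s b"
  shows "inj_on (word_value G) (reduced_words S)"
proof -
  have D: "word_value G ((s, b) # ws) \<in> D s b" if "(s, b) # ws \<in> reduced_words S" for s b ws
    using that
  proof (induction ws arbitrary: s b)
    case Nil
    then show ?case using step[of s \<one> b] one by (simp add: reduced_words_Cons)
  next
    case (Cons l ws)
    obtain t c where l: "l = (t, c)" by (cases l)
    have red: "s \<in> S" "t \<in> S" "l # ws \<in> reduced_words S" "(t, c) \<noteq> (s, \<not> b)"
      using Cons.prems by (auto simp: l reduced_words_Cons)
    have car: "word_value G (l # ws) \<in> carrier G"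
      by (rule word_value_reduced_closed[OF S red(3)])
    have "word_value G (l # ws) \<in> D t c"
      using Cons.IH[of t c] red(3) unfolding l .
    \<comment> \<open>Reducedness enters here: the next letter is not the inverse of
      \<open>(s, b)\<close>, so by disjointness the value of the tail avoids the one domain that
      \<open>step\<close> excludes.\<close>
    then have "word_value G (l # ws) \<notin> D s (\<not> b)"
      using disj[OF red(2,1) car] red(4) by blast
    then show ?case
      using step[OF red(1) car] by simp
  qed
  have "ws = ws'"
    if "ws \<in> reduced_words S" "ws' \<in> reduced_words S" "word_value G ws = word_value G ws'" for ws ws'
    using that
  proof (induction ws arbitrary: ws')
    case Nil
    show ?case
    proof (cases ws')
      case (Cons l vs)
      then show ?thesis
        using Nil D[of "fst l" "snd l" vs] one[of "fst l" "snd l"]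
          reduced_words_Cons[of "fst l" "snd l" vs S] by simp
    qed simp
  next
    case (Cons l ws)
    obtain s b where l: "l = (s, b)" by (cases l)
    have sS: "s \<in> S" "ws \<in> reduced_words S"
      using Cons.prems(1) by (auto simp: l reduced_words_Cons)
    have Ds: "word_value G (l # ws) \<in> D s b"
      using D Cons.prems(1) unfolding l by blast
    show ?case
    proof (cases ws')
      case Nil
      then show ?thesis using Ds one[OF sS(1), of b] Cons.prems(3) by simp
    next
      case (Cons l' vs)
      obtain t c where l': "l' = (t, c)" by (cases l')
      have tS: "t \<in> S" "vs \<in> reduced_words S"
        using Cons.prems(2) by (auto simp: Cons l' reduced_words_Cons)
      have "word_value G (l # ws) \<in> D t c"
        using D[of t c vs] Cons.prems(2,3) unfolding Cons l' by simp
      then have "s = t \<and> b = c"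
        by (rule disj[OF sS(1) tS(1) word_value_reduced_closed[OF S Cons.prems(1)] Ds])
      then have eq: "l' = l"
        unfolding l l' by simp
      have "(if b then s else inv s) \<otimes> word_value G ws = (if b then s else inv s) \<otimes> word_value G vs"
        using Cons.prems(3) unfolding Cons eq l by simp
      moreover have "(if b then s else inv s) \<in> carrier G"
        using S sS(1) by auto
      ultimately have "word_value G ws = word_value G vs"
        using Units_l_cancel Units_eq word_value_reduced_closed[OF S sS(2)] word_value_reduced_closed[OF S tS(2)]
        by blast
      then show ?thesis using Cons.IH[OF sS(2) tS(2)] unfolding Cons eq by simp
    qed
  qed
  then show ?thesis by (rule inj_onI)
qed

end

section \<open>The action on the hyperbolic plane\<close>

text \<open>For a complex quaternion \<open>g\<close> with Hermitian adjoint \<open>g\<^sup>*\<close>, the product \<open>g g\<^sup>*\<close> equals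
  \<open>T + \<i> (A i + B j + C k)\<close> with the real numbers \<open>T = form_t g\<close>, \<open>A = form_i g\<close>, \<open>C = form_k g\<close>.\<close>

definition form_t :: "complex quat \<Rightarrow> real" where
  "form_t g = (cmod (qre g))\<^sup>2 + (cmod (qi g))\<^sup>2 + (cmod (qj g))\<^sup>2 + (cmod (qk g))\<^sup>2"

definition form_i :: "complex quat \<Rightarrow> real" where
  "form_i g = 2 * Im (qi g * cnj (qre g) + qk g * cnj (qj g))"

definition form_k :: "complex quat \<Rightarrow> real" where
  "form_k g = 2 * Im (qk g * cnj (qre g) + qj g * cnj (qi g))"

lemma form_Quat:
  "form_t (Quat a b c e) = Re a * Re a + Im a * Im a + Re b * Re b + Im b * Im b
     + Re c * Re c + Im c * Im c + Re e * Re e + Im e * Im e"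
  "form_i (Quat a b c e) = 2 * (Im b * Re a - Re b * Im a + Im e * Re c - Re e * Im c)"
  "form_k (Quat a b c e) = 2 * (Im e * Re a - Re e * Im a + Im c * Re b - Re c * Im b)"
  by (simp_all add: form_t_def form_i_def form_k_def cmod_power2 flip: power2_eq_square)

text \<open>Left multiplication by \<open>h\<close> turns \<open>g g*\<close> into
  \<open>h g g* h*\<close>. For this \<open>h\<close> that is, up to scale, a boost in the plane of
  \<open>T\<close> and \<open>A\<close> with \<open>x\<^sup>2 + z\<^sup>2\<close> as hyperbolic
  cosine and \<open>2 * x * z\<close> as hyperbolic sine. The \<open>C\<close> direction is scaled
  by the quaternion norm of \<open>h\<close>; a norm of -1 makes this a reflection.\<close>

lemma form_mult_i:
  fixes x z :: real
  defines "h \<equiv> Quat (of_real x) (\<i> * of_real z) 0 0"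
  shows "form_i (quat_mult h g) = (x\<^sup>2 + z\<^sup>2) * form_i g + 2 * x * z * form_t g"
    and "form_k (quat_mult h g) = (x\<^sup>2 - z\<^sup>2) * form_k g"
proof -
  obtain a b c e where g: "g = Quat a b c e" by (cases g)
  show "form_i (quat_mult h g) = (x\<^sup>2 + z\<^sup>2) * form_i g + 2 * x * z * form_t g"
    unfolding h_def g by (simp add: form_Quat power2_eq_square) (simp add: algebra_simps)
  show "form_k (quat_mult h g) = (x\<^sup>2 - z\<^sup>2) * form_k g"
    unfolding h_def g by (simp add: form_Quat power2_eq_square) (simp add: algebra_simps)
qed

text \<open>Here \<open>h\<close> is \<open>\<i>\<close> times \<open>z - \<i> x k\<close>, so the
  boost acts in the plane of \<open>T\<close> and \<open>C\<close>. For positive \<open>x\<close>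
  and \<open>z\<close> it pushes \<open>C\<close> towards negative values.\<close>

lemma form_mult_k:
  fixes x z :: real
  defines "h \<equiv> Quat (\<i> * of_real z) 0 0 (of_real x)"
  shows "form_i (quat_mult h g) = (z\<^sup>2 - x\<^sup>2) * form_i g"
    and "form_k (quat_mult h g) = (x\<^sup>2 + z\<^sup>2) * form_k g - 2 * x * z * form_t g"
proof -
  obtain a b c e where g: "g = Quat a b c e" by (cases g)
  show "form_i (quat_mult h g) = (z\<^sup>2 - x\<^sup>2) * form_i g"
    unfolding h_def g by (simp add: form_Quat power2_eq_square) (simp add: algebra_simps)
  show "form_k (quat_mult h g) = (x\<^sup>2 + z\<^sup>2) * form_k g - 2 * x * z * form_t g"
    unfolding h_def g by (simp add: form_Quat power2_eq_square) (simp add: algebra_simps)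
qed

lemma form_t_pos: "g \<noteq> Quat 0 0 0 0 \<Longrightarrow> form_t g > 0"
  by (cases g) (auto simp: form_t_def less_le add_nonneg_eq_0_iff)

text \<open>The quaternion norm is multiplicative, so the norm of \<open>g g*\<close>, namely
  \<open>T^2 - A^2 - B^2 - C^2\<close>, is the squared modulus of the norm of \<open>g\<close>. In
  the proof \<open>j\<close> is the coefficient \<open>B\<close> and \<open>N\<close> is the norm of
  \<open>g\<close>.\<close>

lemma form_light_cone: "(form_i g)\<^sup>2 + (form_k g)\<^sup>2 \<le> (form_t g)\<^sup>2"
proof (cases g)
  case (Quat a b c e)
  define j where "j = 2 * (Im c * Re a - Re c * Im a + Im b * Re e - Re b * Im e)"
  define N where "N = a\<^sup>2 + b\<^sup>2 + c\<^sup>2 + e\<^sup>2"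
  have "(form_t g)\<^sup>2 = (form_i g)\<^sup>2 + (form_k g)\<^sup>2 + j\<^sup>2 + (Re N)\<^sup>2 + (Im N)\<^sup>2"
    unfolding Quat form_Quat j_def N_def
    by (simp add: power2_eq_square) (simp add: algebra_simps)
  then show ?thesis by simp
qed

text \<open>With \<open>c\<close> and \<open>s\<close> the hyperbolic cosine and sine of the
  translation length, the boost carries the complement of the quarter
  \<open>A < - \<bar>B\<bar>\<close> into the quarter \<open>A > \<bar>B\<bar>\<close>. The worst
  case is the ideal corner \<open>A = - \<bar>B\<bar>\<close>, \<open>T^2 = 2 * B^2\<close>, where
  the claim becomes \<open>2 * (c - 1) > c + 1\<close>; hence the bound 3.\<close>

lemma boost_half_plane:
  fixes T A B c s :: real
  assumes "A\<^sup>2 + B\<^sup>2 \<le> T\<^sup>2" "T > 0" "A \<ge> - \<bar>B\<bar>" "c > 3" "s > 0" "c\<^sup>2 - s\<^sup>2 = 1"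
  shows "c * A + s * T > \<bar>B\<bar>"
proof (cases "A \<ge> 0")
  case True
  have "B\<^sup>2 \<le> T\<^sup>2" using assms(1) by (smt (verit) zero_le_power2)
  then have "\<bar>B\<bar> \<le> T" using assms(2) by (simp add: abs_le_square_iff[symmetric])
  moreover have "s > 1"
  proof -
    have "c\<^sup>2 > 3\<^sup>2" using assms(4) by (intro power_strict_mono) auto
    then have "1\<^sup>2 < s\<^sup>2" using assms(6) by simp
    then show ?thesis using assms(5) power2_less_imp_less[of 1 s] by simp
  qed
  ultimately have "\<bar>B\<bar> < s * T" using assms(2) by (smt (verit) mult_less_cancel_right1)
  then show ?thesis using True assms(4) by (smt (verit) mult_nonneg_nonneg)
next
  case False
  define a b where "a = - A" and "b = \<bar>B\<bar>"
  have ab: "0 < a" "a \<le> b" using False assms(3) by (auto simp: a_def b_def)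
  \<comment> \<open>The target is \<open>b + c * a < s * T\<close>, compared through squares after
    bounding \<open>T^2\<close> below by \<open>a^2 + b^2\<close>. The difference is arranged so
    that the last two summands vanish in the extreme case \<open>a = b\<close> and the first is
    positive exactly because \<open>c > 3\<close>.\<close>
  have "0 < (c - 3) * (c + 1) * b\<^sup>2 + (b - a) * (b + a) + 2 * c * b * (b - a)"
    using ab assms(4) by (intro add_pos_nonneg mult_pos_pos mult_nonneg_nonneg) auto
  also have "\<dots> = (c\<^sup>2 - 1) * (a\<^sup>2 + b\<^sup>2) - (b + c * a)\<^sup>2"
    by (simp add: power2_eq_square algebra_simps)
  also have "\<dots> \<le> (s * T)\<^sup>2 - (b + c * a)\<^sup>2"
  proof -
    have "c\<^sup>2 - 1 = s\<^sup>2" "a\<^sup>2 + b\<^sup>2 \<le> T\<^sup>2" using assms by (auto simp: a_def b_def)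
    then show ?thesis by (simp add: power_mult_distrib mult_left_mono)
  qed
  finally have "b + c * a < s * T"
    using assms by (intro power2_less_imp_less[of _ "s * T"]) auto
  then show ?thesis by (simp add: a_def b_def)
qed

text \<open>The unit exceeds 1 and its product with its conjugate is -1, so the conjugate lies
  strictly between -1 and 0. Half the sum and half the difference of the two are then
  positive.\<close>

lemma fundamental_unit_norm_minus_one_pos:
  assumes "fundamental_unit d (of_int x + of_int y * sqrt (of_int d))" "d > 0"
    and "x\<^sup>2 - d * y\<^sup>2 = -1"
  shows "x > 0" "y > 0"
proof -
  define z where "z = of_int y * sqrt (of_int d)"
  have gt: "of_int x + z > 1"
    using assms(1) by (simp add: fundamental_unit_def Let_def z_def)
  have "real_of_int (x\<^sup>2 - d * y\<^sup>2) = -1" unfolding assms(3) by simp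
  then have prod: "(of_int x + z) * (of_int x - z) = -1"
    using assms(2) by (simp add: z_def algebra_simps power2_eq_square)
  have neg: "of_int x - z < 0"
    using prod gt by (smt (verit) mult_nonneg_nonneg)
  moreover have "of_int x - z > -1"
    using prod gt neg by (smt (verit) mult_less_cancel_right1 mult_minus_right)
  ultimately have "real_of_int x > 0" "z > 0" using gt by linarith+
  then show "x > 0" "y > 0" using assms(2) by (simp_all add: z_def zero_less_mult_iff)
qed

section \<open>The group generated by \<open>u\<close> and \<open>w\<close>\<close>

theorem corollary3p10:
  fixes d x y :: int and u w :: "complex quat"
  assumes "d > 1" and "squarefree d"
    and "fundamental_unit d (of_int x + of_int y * sqrt (of_int d))"
    and "x\<^sup>2 - d * y\<^sup>2 = -1"
    and "x \<noteq> 1"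
    and "u = Quat (of_int x) (of_int y * sqrt_neg d) 0 0"
    and "w = Quat (of_int y * sqrt_neg d) 0 0 (of_int x)"
  shows "u \<in> Units (quat_integers d) \<and> gauss_unit d 2 w \<and>
         free_group (subgroup_generated (units_of (quat_integers d)) {u, w})"
proof -
  define X Z :: real where "X = of_int x" and "Z = of_int y * sqrt (of_int d)"
  \<comment> \<open>Both units have quaternion norm -1, so their inverses are the negatives of their
    quaternion conjugates.\<close>
  define u' w' where "u' = Quat (of_int (- x)) (of_int y * sqrt_neg d) 0 0"
    and "w' = Quat (of_int (- y) * sqrt_neg d) 0 0 (of_int x)"
  define Q where "Q = quat_integers d"
  have xy: "x > 0" "y > 0"
    using fundamental_unit_norm_minus_one_pos assms(1,3,4) by auto
  then have x2: "x \<ge> 2" using assms(5) by simp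
  have forms: "u = Quat (of_real X) (\<i> * of_real Z) 0 0"
    "u' = Quat (of_real (- X)) (\<i> * of_real Z) 0 0"
    "w = Quat (\<i> * of_real Z) 0 0 (of_real X)"
    "w' = Quat (\<i> * of_real (- Z)) 0 0 (of_real X)"
    using assms(1) by (simp_all add: assms(6,7) u'_def w'_def X_def Z_def sqrt_neg_eq)
  have "real_of_int (x\<^sup>2 - d * y\<^sup>2) = -1" unfolding assms(4) by simp
  then have Z2: "Z\<^sup>2 = X\<^sup>2 + 1"
    using assms(1) by (simp add: X_def Z_def power_mult_distrib algebra_simps)
  then have Z2': "complex_of_real Z * complex_of_real Z =
      complex_of_real X * complex_of_real X + 1"
    by (metis of_real_add of_real_1 of_real_mult power2_eq_square)
  have XZ: "X \<ge> 2" "Z > 0" using x2 xy assms(1) by (simp_all add: X_def Z_def)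

  interpret Q: monoid Q unfolding Q_def by (rule monoid_quat_integers)
  have car: "{u, u', w, w'} \<subseteq> carrier Q"
    using of_int_ring_of_integers_quad_field[of 0 "sqrt_neg d"]
      of_int_ring_of_integers_quad_field[of "- x" "sqrt_neg d"]
      of_int_times_ring_of_integers_quad_field[OF algebraic_int_sqrt_neg, of y d]
      of_int_times_ring_of_integers_quad_field[OF algebraic_int_sqrt_neg, of "- y" d]
    by (simp add: Q_def quat_integers_def quat_order_def assms(6,7) u'_def w'_def)
  have mult: "a \<otimes>\<^bsub>Q\<^esub> b = quat_mult a b" and one: "\<one>\<^bsub>Q\<^esub> = Quat 1 0 0 0" for a b
    by (simp_all add: Q_def quat_integers_def quat_order_def)
  have invs: "u \<otimes>\<^bsub>Q\<^esub> u' = \<one>\<^bsub>Q\<^esub>" "u' \<otimes>\<^bsub>Q\<^esub> u = \<one>\<^bsub>Q\<^esub>" "w \<otimes>\<^bsub>Q\<^esub> w' = \<one>\<^bsub>Q\<^esub>" "w' \<otimes>\<^bsub>Q\<^esub> w = \<one>\<^bsub>Q\<^esub>"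
    unfolding mult one forms by (simp_all add: algebra_simps Z2')
  have units: "u \<in> Units Q" "w \<in> Units Q"
    using car invs unfolding Units_def by blast+

  have "gauss_unit d 2 w"
    unfolding gauss_unit_def
  proof (intro conjI exI)
    \<comment> \<open>The norm equation makes \<open>y\<^sup>2 * d - 1\<close> equal to the square
      of \<open>x\<close>; the other two squares are 0.\<close>
    show "sum_of_three_squares (y\<^sup>2 * d + 1) \<or> sum_of_three_squares (y\<^sup>2 * d - 1)"
      unfolding sum_of_three_squares_def
      using assms(4) by (intro disjI2 exI[of _ x] exI[of _ 0]) (simp add: algebra_simps)
    show "w = Quat (of_int y * sqrt_neg d) (of_int 0) (of_int 0) (of_int x)"
      by (simp add: assms(7))
  qed (use assms(1,2) units xy in \<open>auto simp: Q_def\<close>)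

  define U where "U = units_of Q"
  define H where "H = subgroup_generated U {u, w}"
  interpret U: group U unfolding U_def by (rule Q.units_group)
  interpret H: group H unfolding H_def by simp
  have U_car: "{u, w} \<subseteq> carrier U" using units by (simp add: U_def units_of_carrier)
  \<comment> \<open>Evaluation of words takes place in \<open>H\<close>, so generation inside
    \<open>U\<close> has to be restated as generation inside \<open>H\<close>; this is the
    idempotence of \<open>subgroup_generated\<close>.\<close>
  have H_car: "carrier H = generate H {u, w}"
    using carrier_subgroup_generated[of H "{u, w}"] U.subgroup_generated2[of "{u, w}"]
      U_car U.subgroup_generated_subset_carrier_subset[of "{u, w}"]
    by (simp add: H_def Int_absorb1)
  have S: "{u, w} \<subseteq> carrier H"
    by (subst H_car) (auto intro: generate.incl)
  have Hmult: "a \<otimes>\<^bsub>H\<^esub> b = quat_mult a b" and Hone: "\<one>\<^bsub>H\<^esub> = Quat 1 0 0 0" for a b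
    by (simp_all add: H_def U_def units_of_mult units_of_one mult one)
  have "inv\<^bsub>Q\<^esub> u = u'" "inv\<^bsub>Q\<^esub> w = w'"
    using Q.inv_unique' car invs by auto
  then have Hinv: "inv\<^bsub>H\<^esub> u = u'" "inv\<^bsub>H\<^esub> w = w'"
    using S units Q.units_of_inv U.inv_subgroup_generated[of _ "{u, w}"]
    by (auto simp: H_def U_def)
  have "u \<noteq> w"
    using XZ by (auto simp: forms complex_eq_iff)

  have t_pos: "form_t g > 0" if "g \<in> carrier H" for g
  proof (rule form_t_pos)
    show "g \<noteq> Quat 0 0 0 0"
    proof
      assume "g = Quat 0 0 0 0"
      then have "g \<otimes>\<^bsub>H\<^esub> inv\<^bsub>H\<^esub> g = Quat 0 0 0 0"
        unfolding Hmult by (cases "inv\<^bsub>H\<^esub> g") simp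
      with H.r_inv[OF that] show False by (simp add: Hone)
    qed
  qed
  \<comment> \<open>In the uses below, \<open>A\<close> and \<open>B\<close> are
    \<open>form_i g\<close> and \<open>form_k g\<close> up to order and sign, so this one inequality
    serves all four letters.\<close>
  have boost: "(X\<^sup>2 + Z\<^sup>2) * A + 2 * X * Z * form_t g > \<bar>B\<bar>"
    if "g \<in> carrier H" "A \<ge> - \<bar>B\<bar>" "A\<^sup>2 + B\<^sup>2 = (form_i g)\<^sup>2 + (form_k g)\<^sup>2" for g A B
  proof (rule boost_half_plane)
    \<comment> \<open>The hyperbolic cosine is \<open>2 * X\<^sup>2 + 1\<close>. It is at least 9
      here, while \<open>X = 1\<close> would give exactly the critical value 3.\<close>
    have "X\<^sup>2 \<ge> 2\<^sup>2" using XZ by (intro power_mono) auto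
    then show "X\<^sup>2 + Z\<^sup>2 > 3" using Z2 by simp
    show "(X\<^sup>2 + Z\<^sup>2)\<^sup>2 - (2 * X * Z)\<^sup>2 = 1"
      using Z2 by (simp add: power_mult_distrib) (simp add: power2_eq_square algebra_simps)
  qed (use that t_pos form_light_cone XZ in auto)

  have form_u: "form_i (quat_mult u g) = (X\<^sup>2 + Z\<^sup>2) * form_i g + 2 * X * Z * form_t g"
    "form_k (quat_mult u g) = - form_k g"
    "form_i (quat_mult u' g) = (X\<^sup>2 + Z\<^sup>2) * form_i g - 2 * X * Z * form_t g"
    "form_k (quat_mult u' g) = - form_k g" for g
    unfolding forms form_mult_i by (simp_all add: Z2)
  have form_w: "form_k (quat_mult w g) = (X\<^sup>2 + Z\<^sup>2) * form_k g - 2 * X * Z * form_t g"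
    "form_i (quat_mult w g) = form_i g"
    "form_k (quat_mult w' g) = (X\<^sup>2 + Z\<^sup>2) * form_k g + 2 * X * Z * form_t g"
    "form_i (quat_mult w' g) = form_i g" for g
    unfolding forms form_mult_k by (simp_all add: Z2)

  \<comment> \<open>These are the four open quarters bounded by the bisectors where
    \<open>form_i\<close> and \<open>form_k\<close> agree in modulus, pulled back along the orbit
    map of the point where the axes meet. The signs for \<open>w\<close> are reversed because
    \<open>w\<close> decreases \<open>form_k\<close>. The identity lies at the crossing of the
    bisectors, hence in no quarter.\<close>
  define D :: "complex quat \<Rightarrow> bool \<Rightarrow> complex quat set" where
    "D s b = (if s = u then {g. (if b then form_i g else - form_i g) > \<bar>form_k g\<bar>}
       else {g. (if b then - form_k g else form_k g) > \<bar>form_i g\<bar>})" for s b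
  have inj: "inj_on (word_value H) (reduced_words {u, w})"
  proof (rule H.ping_pong_inj_on_word_value[where D = D, OF S])
    show "\<one>\<^bsub>H\<^esub> \<notin> D s b" for s b
      by (simp add: D_def Hone form_i_def form_k_def)
  next
    fix s b t c g
    assume "s \<in> {u, w}" "t \<in> {u, w}" "g \<in> D s b" "g \<in> D t c"
    then show "s = t \<and> b = c"
      using \<open>u \<noteq> w\<close> by (cases b; cases c) (auto simp: D_def split: if_splits)
  next
    fix s b g
    assume s: "s \<in> {u, w}" and g: "g \<in> carrier H" and notin: "g \<notin> D s (\<not> b)"
    show "(if b then s else inv\<^bsub>H\<^esub> s) \<otimes>\<^bsub>H\<^esub> g \<in> D s b"
    proof (cases "s = u")
      case True
      have bu: "- \<bar>form_k g\<bar> \<le> (if b then form_i g else - form_i g)"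
        using notin by (auto simp: D_def True split: if_splits)
      have "\<bar>form_k g\<bar> < (X\<^sup>2 + Z\<^sup>2) * (if b then form_i g else - form_i g) + 2 * X * Z * form_t g"
        by (rule boost[OF g bu]) simp
      then show ?thesis
        by (cases b) (simp_all add: D_def True Hinv Hmult form_u)
    next
      case False
      then have w: "s = w" using s by simp
      have bw: "- \<bar>form_i g\<bar> \<le> (if b then - form_k g else form_k g)"
        using notin False by (auto simp: D_def split: if_splits)
      have "\<bar>form_i g\<bar> < (X\<^sup>2 + Z\<^sup>2) * (if b then - form_k g else form_k g) + 2 * X * Z * form_t g"
        by (rule boost[OF g bw]) simp
      then show ?thesis
        using False by (cases b) (simp_all add: D_def w Hinv Hmult form_w)
    qed
  qed
  have "free_basis H {u, w}"
    unfolding free_basis_def bij_betw_def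
    using S inj H.word_value_image_reduced_words[OF S] H_car by simp
  then have "free_group H"
    unfolding free_group_def using H.group_axioms by blast
  then show ?thesis
    using units \<open>gauss_unit d 2 w\<close> by (simp add: H_def U_def Q_def)
qed

end
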